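(* Let $x\in\mathbb{R}$ be a quadratic irrational number with (eventually periodic) regular continued fraction expansion $x=[a_0;a_1,\dots,a_\ell,\overline{a_{\ell+1},\dots,a_{\ell+p}}]$. Then the orbit $(R^n(x-a_0))_{n\ge 0}$ of $x-a_0$ under the Romik map $R$ is eventually periodic.
   Context: A quadratic irrational number is a real number of the form $\frac{a+\sqrt b}{c}$ with $a,b,c\in\mathbb{Z}$, $b\ge 1$ not a perfect square, and $c\ne 0$. The regular continued fraction (RCF) expansion $x=[a_0;a_1,a_2,\dots]$ has $a_0=\lfloor x\rfloor\in\mathbb{Z}$ and $a_n\in\mathbb{N}=\{1,2,\dots\}$ for $n\ge1$; the bar indicates the block that is repeated indefinitely. The Romik map $R:[0,1]\to[0,1]$ is defined by $R(x)=\frac{x}{1-2x}$ for $0\le x\le \frac13$, $R(x)=\frac1x-2$ for $\frac13\le x\le\frac12$, and $R(x)=2-\frac1x$ for $\frac12\le x\le 1$. An orbit $(R^n(y))_{n\ge0}$ is eventually periodic if there exist integers $0\le r<s$ with $R^r(y)=R^s(y)$. *)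

theory Defs
  imports "HOL-Analysis.Analysis" "HOL-Computational_Algebra.Nth_Powers"
begin

definition quadratic_irrational :: "real \<Rightarrow> bool" where
  "quadratic_irrational x \<longleftrightarrow>
     (\<exists>a b c :: int. b \<ge> 1 \<and> \<not> is_square b \<and> c \<noteq> 0 \<and>
        x = (of_int a + sqrt (of_int b)) / of_int c)"

text \<open>\<open>rcf_convergent a n\<close> is the finite continued fraction
  \<open>[a 0; a 1, \<dots>, a n]\<close>.\<close>

fun rcf_convergent :: "(nat \<Rightarrow> int) \<Rightarrow> nat \<Rightarrow> real" where
  "rcf_convergent a 0 = of_int (a 0)"
| "rcf_convergent a (Suc n) = of_int (a 0) + 1 / rcf_convergent (\<lambda>k. a (Suc k)) n"

text \<open>The (infinite) regular continued fraction expansion \<open>x = [a 0; a 1, a 2, \<dots>]\<close>, whose value is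
  the limit of its convergents.\<close>

definition rcf_expansion :: "real \<Rightarrow> (nat \<Rightarrow> int) \<Rightarrow> bool" where
  "rcf_expansion x a \<longleftrightarrow>
     a 0 = \<lfloor>x\<rfloor> \<and> (\<forall>n\<ge>1. a n \<ge> 1) \<and> rcf_convergent a \<longlonglongrightarrow> x"

text \<open>The Romik map is a self-map of \<open>{0..1}\<close>; its values outside that interval are irrelevant.
  The branches agree at \<open>1/3\<close> and \<open>1/2\<close>.\<close>

definition romik :: "real \<Rightarrow> real" where
  "romik x = (if x \<le> 1/3 then x / (1 - 2 * x)
              else if x \<le> 1/2 then 1 / x - 2
              else 2 - 1 / x)"

lemma romik_branches:
  "0 \<le> x \<Longrightarrow> x \<le> 1/3 \<Longrightarrow> romik x = x / (1 - 2 * x)"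
  "1/3 \<le> x \<Longrightarrow> x \<le> 1/2 \<Longrightarrow> romik x = 1 / x - 2"
  "1/2 \<le> x \<Longrightarrow> x \<le> 1 \<Longrightarrow> romik x = 2 - 1 / x"
proof -
  show "romik x = 1 / x - 2" if "1/3 \<le> x" "x \<le> 1/2"
  proof (cases "x = 1/3")
    case True
    then show ?thesis by (simp only: romik_def) simp
  qed (use that in \<open>auto simp: romik_def\<close>)
  show "romik x = 2 - 1 / x" if "1/2 \<le> x" "x \<le> 1"
  proof (cases "x = 1/2")
    case True
    then show ?thesis by (simp only: romik_def) simp
  qed (use that in \<open>auto simp: romik_def\<close>)
qed (auto simp: romik_def)

lemma romik_self_map: "x \<in> {0..1} \<Longrightarrow> romik x \<in> {0..1}"
  by (auto simp: romik_def field_simps)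

definition eventually_periodic_orbit :: "('a \<Rightarrow> 'a) \<Rightarrow> 'a \<Rightarrow> bool" where
  "eventually_periodic_orbit f y \<longleftrightarrow> (\<exists>r s. r < s \<and> (f ^^ r) y = (f ^^ s) y)"

end

theory Submission
  imports Defs
begin

text \<open>Lagrange's argument on quadratic irrationals, carried out for the Romik map itself in place of
  the Gauss map.

  Each branch of the Romik map is a Moebius transformation with integer coefficients and determinant
  \<open>\<plusminus>1\<close>.  It maps its interval bijectively onto \<open>{0..1}\<close>, hence the complement of the interval
  in the projective line onto the complement of \<open>{0..1}\<close>.  If \<open>y\<close> is a quadratic irrational
  in \<open>{0..1}\<close> with conjugate \<open>z\<close>, both being roots of an integral polynomial
  \<open>A t\<^sup>2 + B t + C\<close>, then the images of \<open>y\<close> and \<open>z\<close> under the branch used at \<open>y\<close> are again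
  roots of such a polynomial, with the same discriminant (\<open>romik_step\<close>).

  If \<open>z\<close> lies outside \<open>{0..1}\<close>, so does its image.  A polynomial with exactly one root between
  \<open>0\<close> and \<open>1\<close> takes values of opposite signs there, and only finitely many integral ones have
  a given discriminant (\<open>finite_reduced_irrationals\<close>); so from then on the orbit stays in a
  finite set.  If \<open>z\<close> lies in \<open>{0..1}\<close> but not in the interval of the branch used at \<open>y\<close>, its
  image falls outside \<open>{0..1}\<close>.  If it lies in that interval, then the branch moves the conjugate
  roots farther apart; as \<open>\<bar>A\<bar> \<bar>y - z\<bar>\<close> is the square root of the discriminant, the positive integer
  \<open>\<bar>A\<bar>\<close> decreases, which can happen only finitely often (\<open>orbit_reaches_reduced\<close>).\<close>

section \<open>Conjugate quadratic irrationals under the Romik map\<close>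

text \<open>\<open>y\<close> and \<open>z\<close> are irrational and are the two roots, with multiplicity, of the integral quadratic
  polynomial \<open>A t\<^sup>2 + B t + C\<close>, expressed by Vieta's formulas.\<close>

definition conjugate_roots :: "int \<Rightarrow> int \<Rightarrow> int \<Rightarrow> real \<Rightarrow> real \<Rightarrow> bool" where
  "conjugate_roots A B C y z \<longleftrightarrow> A \<noteq> 0 \<and> y \<notin> \<rat> \<and> z \<notin> \<rat> \<and>
     of_int B = - of_int A * (y + z) \<and> of_int C = of_int A * y * z"

lemma irrational_neq:
  fixes y :: real
  assumes "y \<notin> \<rat>"
  shows "y \<noteq> 0" "y \<noteq> 1" "y \<noteq> 1/2" "y \<noteq> 1/3"
proof -
  have "(1/2::real) \<in> \<rat>" "(1/3::real) \<in> \<rat>" by (intro Rats_divide; simp)+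
  then show "y \<noteq> 0" "y \<noteq> 1" "y \<noteq> 1/2" "y \<noteq> 1/3"
    using assms by (metis Rats_0, metis Rats_1, metis+)
qed

lemma irrational_reciprocal_iff: "1 / y \<in> \<rat> \<longleftrightarrow> y \<in> \<rat>" for y :: real
  using Rats_divide[OF Rats_1, of y] Rats_divide[OF Rats_1, of "1 / y"]
  unfolding divide_divide_eq_right mult_1 div_by_1 by blast

text \<open>In the coordinate \<open>1/y\<close> all three branches are translations up to sign and inversion.\<close>

lemma irrational_branches:
  fixes y :: real
  assumes "y \<notin> \<rat>"
  shows "y / (1 - 2 * y) \<notin> \<rat>" "1 / y - 2 \<notin> \<rat>" "2 - 1 / y \<notin> \<rat>"
proof -
  have inv: "1 / y \<notin> \<rat>"
    using assms irrational_reciprocal_iff by blast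
  show *: "1 / y - 2 \<notin> \<rat>"
  proof
    assume "1 / y - 2 \<in> \<rat>"
    from Rats_add[OF this, of 2] inv show False by simp
  qed
  show "2 - 1 / y \<notin> \<rat>"
  proof
    assume "2 - 1 / y \<in> \<rat>"
    from Rats_diff[OF _ this, of 2] inv show False by simp
  qed
  have "1 / (y / (1 - 2 * y)) = 1 / y - 2"
    using irrational_neq(1)[OF assms] by (simp add: diff_divide_distrib)
  then show "y / (1 - 2 * y) \<notin> \<rat>"
    using * irrational_reciprocal_iff by metis
qed

lemma abs_less_of_factor:
  fixes A A' :: int and q :: real
  assumes "of_int A' = of_int A * q" "A \<noteq> 0" "\<bar>q\<bar> < 1"
  shows "\<bar>A'\<bar> < \<bar>A\<bar>"
proof -
  have "real_of_int \<bar>A'\<bar> = real_of_int \<bar>A\<bar> * \<bar>q\<bar>"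
    using assms(1) by (simp add: abs_mult)
  also have "\<dots> < real_of_int \<bar>A\<bar> * 1"
    using assms by (intro mult_strict_left_mono) auto
  finally show ?thesis by simp
qed

text \<open>The branch used at \<open>y\<close> acts on both conjugate roots; it multiplies the leading coefficient by
  \<open>(1 - 2 y) (1 - 2 z)\<close> in the first branch and by \<open>y z\<close> in the other two.  If the image \<open>z'\<close> of
  \<open>z\<close> lies in \<open>{0..1}\<close>, then \<open>z\<close> lies in the interval of the same branch and this factor has
  absolute value below \<open>1\<close>.\<close>

lemma romik_step:
  assumes conj: "conjugate_roots A B C y z" and y: "y \<in> {0..1}"
  shows "\<exists>A' B' C' z'. conjugate_roots A' B' C' (romik y) z' \<and>
           B'\<^sup>2 - 4 * A' * C' = B\<^sup>2 - 4 * A * C \<and>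
           (z' \<notin> {0..1} \<or> (z \<in> {0..1} \<and> \<bar>A'\<bar> < \<bar>A\<bar>))"
proof -
  have A: "A \<noteq> 0" and irr: "y \<notin> \<rat>" "z \<notin> \<rat>"
    and B: "of_int B = - of_int A * (y + z)" and C: "of_int C = of_int A * y * z"
    using conj by (auto simp: conjugate_roots_def)
  note ny = irrational_neq[OF irr(1)] and nz = irrational_neq[OF irr(2)]
  have y01: "0 < y" "y < 1" using y ny by auto
  have C0: "C \<noteq> 0"
  proof
    assume "C = 0"
    with C A ny(1) nz(1) show False by simp
  qed
  \<comment> \<open>The polynomial with roots \<open>1/y\<close> and \<open>1/z\<close> has the coefficients in reverse order.\<close>
  define u w where "u = 1 / y" and "w = 1 / z"
  have recip: "of_int C * u + of_int C * w = - of_int B" "of_int C * (u * w) = of_int A"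
    unfolding u_def w_def B C using ny(1) nz(1) by (simp_all add: field_simps)
  consider "y < 1/3" | "1/3 < y" "y < 1/2" | "1/2 < y"
    using ny(3,4) by linarith
  then show ?thesis
  proof cases
    case 1
    have r: "romik y = y / (1 - 2 * y)"
      using 1 by (simp add: romik_def)
    have A': "of_int (A + 2 * B + 4 * C) = of_int A * ((1 - 2 * y) * (1 - 2 * z))"
      using B C by (simp add: algebra_simps)
    then have "real_of_int (A + 2 * B + 4 * C) \<noteq> 0"
      using A ny nz by auto
    then have "A + 2 * B + 4 * C \<noteq> 0" by linarith
    have nz': "1 - 2 * y \<noteq> 0" "1 - 2 * z \<noteq> 0" using ny nz by auto
    have sum: "p * q * (u / p + v / q) = u * q + v * p"
      and prod: "p * q * (u / p) * (v / q) = u * v" if "p \<noteq> 0" "q \<noteq> 0" for p q u v :: real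
      using that by (simp_all add: field_simps)
    have "of_int (B + 4 * C) = - of_int A * (y * (1 - 2 * z) + z * (1 - 2 * y))"
      using B C by (simp add: algebra_simps)
    also have "\<dots> = - of_int (A + 2 * B + 4 * C) * (y / (1 - 2 * y) + z / (1 - 2 * z))"
      unfolding A' using sum[OF nz', of y z] by (simp only: mult.assoc mult_minus_left)
    finally have B': "of_int (B + 4 * C) = \<dots>" .
    have C': "of_int C = of_int (A + 2 * B + 4 * C) * (y / (1 - 2 * y)) * (z / (1 - 2 * z))"
      unfolding A' C using prod[OF nz', of y z] by (simp only: mult.assoc)
    have "conjugate_roots (A + 2 * B + 4 * C) (B + 4 * C) C (romik y) (z / (1 - 2 * z))"
      unfolding conjugate_roots_def r
      using \<open>A + 2 * B + 4 * C \<noteq> 0\<close> irrational_branches(1)[OF irr(1)]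
        irrational_branches(1)[OF irr(2)] B' C' by blast
    moreover have "(B + 4 * C)\<^sup>2 - 4 * (A + 2 * B + 4 * C) * C = B\<^sup>2 - 4 * A * C"
      by (simp add: power2_eq_square algebra_simps)
    moreover have "\<bar>A + 2 * B + 4 * C\<bar> < \<bar>A\<bar>" "z \<in> {0..1}" if "z / (1 - 2 * z) \<in> {0..1}"
    proof -
      \<comment> \<open>For \<open>z > 1/2\<close> the image of \<open>z\<close> under the first branch is negative.\<close>
      have "1 - 2 * z > 0"
      proof (rule ccontr)
        assume "\<not> 1 - 2 * z > 0"
        with nz(3) have neg: "1 - 2 * z < 0" by linarith
        with that show False by (simp add: divide_simps)
      qed
      with that have z: "0 \<le> z" "z \<le> 1/3" by (auto simp: divide_simps)
      then show "z \<in> {0..1}" by simp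
      have "\<bar>1 - 2 * y\<bar> * \<bar>1 - 2 * z\<bar> < 1 * 1"
        using 1 y01 z by (intro mult_less_le_imp_less) auto
      then show "\<bar>A + 2 * B + 4 * C\<bar> < \<bar>A\<bar>"
        by (intro abs_less_of_factor[OF A' A]) (simp add: abs_mult)
    qed
    ultimately show ?thesis by blast
  next
    case 2
    have r: "romik y = 1 / y - 2"
      using 2 by (simp add: romik_def)
    have B': "of_int (B + 4 * C) = - of_int C * ((1 / y - 2) + (1 / z - 2))"
      and C': "of_int (A + 2 * B + 4 * C) = of_int C * (1 / y - 2) * (1 / z - 2)"
      using recip unfolding u_def[symmetric] w_def[symmetric] by (simp_all add: algebra_simps)
    have "conjugate_roots C (B + 4 * C) (A + 2 * B + 4 * C) (romik y) (1 / z - 2)"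
      unfolding conjugate_roots_def r
      using C0 irrational_branches(2)[OF irr(1)] irrational_branches(2)[OF irr(2)] B' C' by blast
    moreover have "(B + 4 * C)\<^sup>2 - 4 * C * (A + 2 * B + 4 * C) = B\<^sup>2 - 4 * A * C"
      by (simp add: power2_eq_square algebra_simps)
    moreover have "\<bar>C\<bar> < \<bar>A\<bar>" "z \<in> {0..1}" if "1 / z - 2 \<in> {0..1}"
    proof -
      have "1 / z > 0" using that unfolding atLeastAtMost_iff by linarith
      then have "z > 0" by simp
      with that have z: "0 \<le> z" "z \<le> 1" by (auto simp: field_simps)
      then show "z \<in> {0..1}" by simp
      have "\<bar>y\<bar> * \<bar>z\<bar> < 1 * 1"
        using y01 z nz by (intro mult_strict_mono) auto
      then show "\<bar>C\<bar> < \<bar>A\<bar>"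
        by (intro abs_less_of_factor[of _ _ "y * z"]) (use A C in \<open>auto simp: abs_mult\<close>)
    qed
    ultimately show ?thesis by blast
  next
    case 3
    have r: "romik y = 2 - 1 / y"
      using 3 by (simp add: romik_def)
    have B': "of_int (- (B + 4 * C)) = - of_int C * ((2 - 1 / y) + (2 - 1 / z))"
      and C': "of_int (A + 2 * B + 4 * C) = of_int C * (2 - 1 / y) * (2 - 1 / z)"
      using recip unfolding u_def[symmetric] w_def[symmetric] by (simp_all add: algebra_simps)
    have "conjugate_roots C (- (B + 4 * C)) (A + 2 * B + 4 * C) (romik y) (2 - 1 / z)"
      unfolding conjugate_roots_def r
      using C0 irrational_branches(3)[OF irr(1)] irrational_branches(3)[OF irr(2)] B' C' by blast
    moreover have "(- (B + 4 * C))\<^sup>2 - 4 * C * (A + 2 * B + 4 * C) = B\<^sup>2 - 4 * A * C"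
      by (simp add: power2_eq_square algebra_simps)
    moreover have "\<bar>C\<bar> < \<bar>A\<bar>" "z \<in> {0..1}" if "2 - 1 / z \<in> {0..1}"
    proof -
      have "1 / z > 0" using that unfolding atLeastAtMost_iff by linarith
      then have "z > 0" by simp
      with that have z: "0 \<le> z" "z \<le> 1" by (auto simp: field_simps)
      then show "z \<in> {0..1}" by simp
      have "\<bar>y\<bar> * \<bar>z\<bar> < 1 * 1"
        using y01 z nz by (intro mult_strict_mono) auto
      then show "\<bar>C\<bar> < \<bar>A\<bar>"
        by (intro abs_less_of_factor[of _ _ "y * z"]) (use A C in \<open>auto simp: abs_mult\<close>)
    qed
    ultimately show ?thesis by blast
  qed
qed

text \<open>The analogue for the Romik map of reduced quadratic irrationals: those in \<open>{0..1}\<close> whose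
  conjugate lies outside \<open>{0..1}\<close>.  Here \<open>D\<close> is the discriminant of some integral polynomial
  defining the number, not necessarily a primitive one.\<close>

definition reduced_irrationals :: "int \<Rightarrow> real set" where
  "reduced_irrationals D = {y \<in> {0..1}. \<exists>A B C z. conjugate_roots A B C y z \<and>
     B\<^sup>2 - 4 * A * C = D \<and> z \<notin> {0..1}}"

lemma romik_reduced:
  assumes "y \<in> reduced_irrationals D"
  shows "romik y \<in> reduced_irrationals D"
proof -
  obtain A B C z where y: "y \<in> {0..1}" and conj: "conjugate_roots A B C y z"
    and D: "B\<^sup>2 - 4 * A * C = D" and z: "z \<notin> {0..1}"
    using assms unfolding reduced_irrationals_def by blast
  from romik_step[OF conj y] z obtain A' B' C' z' where
    "conjugate_roots A' B' C' (romik y) z'" "B'\<^sup>2 - 4 * A' * C' = D" "z' \<notin> {0..1}"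
    unfolding D by blast
  with romik_self_map[OF y] show ?thesis
    unfolding reduced_irrationals_def by blast
qed

section \<open>Descent on the leading coefficient\<close>

lemma orbit_reaches_reduced:
  assumes "conjugate_roots A B C y z" "y \<in> {0..1}"
  shows "\<exists>n. (romik ^^ n) y \<in> reduced_irrationals (B\<^sup>2 - 4 * A * C)"
  using assms
proof (induction "nat \<bar>A\<bar>" arbitrary: A B C y z rule: less_induct)
  case less
  obtain A' B' C' z' where *: "conjugate_roots A' B' C' (romik y) z'"
      "B'\<^sup>2 - 4 * A' * C' = B\<^sup>2 - 4 * A * C"
      "z' \<notin> {0..1} \<or> (z \<in> {0..1} \<and> \<bar>A'\<bar> < \<bar>A\<bar>)"
    using romik_step[OF less.prems] by blast
  have y': "romik y \<in> {0..1}"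
    using less.prems romik_self_map by blast
  show ?case
  proof (cases "z' \<in> {0..1}")
    case True
    then have "nat \<bar>A'\<bar> < nat \<bar>A\<bar>" using * by auto
    from less.hyps[OF this *(1) y'] obtain n
      where "(romik ^^ n) (romik y) \<in> reduced_irrationals (B\<^sup>2 - 4 * A * C)"
      unfolding *(2) by blast
    then have "(romik ^^ Suc n) y \<in> reduced_irrationals (B\<^sup>2 - 4 * A * C)"
      by (simp only: funpow_Suc_right o_apply)
    then show ?thesis by blast
  next
    case False
    then have "(romik ^^ 1) y \<in> reduced_irrationals (B\<^sup>2 - 4 * A * C)"
      using * y' unfolding reduced_irrationals_def by auto
    then show ?thesis by blast
  qed
qed

section \<open>Finiteness of the reduced irrationals\<close>

text \<open>With \<open>u = C\<close> and \<open>v = A + B + C\<close> the values at \<open>0\<close> and \<open>1\<close>, the polynomial is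
  \<open>u (1 - t)\<^sup>2 + (B + 2 C) t (1 - t) + v t\<^sup>2\<close>, and its discriminant is
  \<open>(B + 2 C)\<^sup>2 - 4 u v\<close>; so \<open>u v < 0\<close> bounds all coefficients.\<close>

lemma coefficient_bounds:
  fixes A B C :: int
  assumes "C * (A + B + C) < 0"
  defines "D \<equiv> B\<^sup>2 - 4 * A * C"
  shows "A \<in> {-3 * D..3 * D}" "B \<in> {-3 * D..3 * D}" "C \<in> {-3 * D..3 * D}"
proof -
  define v b where "v = A + B + C" and "b = B + 2 * C"
  have D: "D = b\<^sup>2 - 4 * (C * v)"
    by (simp add: D_def v_def b_def power2_eq_square algebra_simps)
  have neg: "C * v < 0" using assms(1) by (simp add: v_def)
  then have nz: "C \<noteq> 0" "v \<noteq> 0" by auto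
  have uv: "\<bar>C\<bar> * \<bar>v\<bar> = - (C * v)" using neg by (simp add: abs_mult[symmetric])
  have b2: "0 \<le> b\<^sup>2" by simp
  have "\<bar>C\<bar> * 1 \<le> \<bar>C\<bar> * \<bar>v\<bar>" "1 * \<bar>v\<bar> \<le> \<bar>C\<bar> * \<bar>v\<bar>"
    using nz by (intro mult_left_mono mult_right_mono; simp)+
  then have bounds: "\<bar>C\<bar> \<le> D" "\<bar>v\<bar> \<le> D" using D uv neg b2 by linarith+
  have "\<bar>b\<bar> \<le> b\<^sup>2"
    using self_le_power[of "\<bar>b\<bar>" 2] by (cases "b = 0") auto
  then have "\<bar>b\<bar> \<le> D" using D neg by linarith
  with bounds show "A \<in> {-3 * D..3 * D}" "B \<in> {-3 * D..3 * D}" "C \<in> {-3 * D..3 * D}"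
    unfolding v_def b_def by auto
qed

lemma finite_quadratic_roots:
  fixes A B C :: real
  assumes "A \<noteq> 0"
  shows "finite {t. A * t\<^sup>2 + B * t + C = 0}"
proof -
  have "{t. A * t\<^sup>2 + B * t + C = 0} = {t. poly [:C, B, A:] t = 0}"
    by (simp add: power2_eq_square algebra_simps)
  then show ?thesis using assms poly_roots_finite[of "[:C, B, A:]"] by simp
qed

lemma finite_reduced_irrationals: "finite (reduced_irrationals D)"
proof -
  let ?I = "{-3 * D..3 * D}"
  let ?roots = "\<lambda>(A, B, C). {t. of_int A * t\<^sup>2 + of_int B * t + of_int C = (0::real)}"
  have "reduced_irrationals D \<subseteq> (\<Union>q \<in> {q \<in> ?I \<times> ?I \<times> ?I. fst q \<noteq> 0}. ?roots q)"
  proof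
    fix y assume "y \<in> reduced_irrationals D"
    then obtain A B C z where y: "y \<in> {0..1}" and conj: "conjugate_roots A B C y z"
      and D: "B\<^sup>2 - 4 * A * C = D" and z: "z \<notin> {0..1}"
      unfolding reduced_irrationals_def by blast
    have A: "A \<noteq> 0" and irr: "y \<notin> \<rat>"
      and B: "of_int B = - of_int A * (y + z)" and C: "of_int C = of_int A * y * z"
      using conj by (auto simp: conjugate_roots_def)
    have y01: "0 < y" "y < 1" using y irrational_neq[OF irr] by auto
    have "z * (1 - z) < 0"
      using z by (auto simp: mult_less_0_iff)
    moreover have "0 < (of_int A)\<^sup>2 * (y * (1 - y))"
      using A y01 by simp
    ultimately have "(of_int A)\<^sup>2 * (y * (1 - y)) * (z * (1 - z)) < 0"
      by (rule mult_pos_neg[rotated])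
    also have "(of_int A)\<^sup>2 * (y * (1 - y)) * (z * (1 - z)) = of_int (C * (A + B + C))"
      unfolding of_int_mult of_int_add B C by (simp add: power2_eq_square algebra_simps)
    finally have "C * (A + B + C) < 0" by linarith
    from coefficient_bounds[OF this] have "(A, B, C) \<in> {q \<in> ?I \<times> ?I \<times> ?I. fst q \<noteq> 0}"
      using A unfolding D by simp
    moreover have "y \<in> ?roots (A, B, C)"
      by (simp add: B C power2_eq_square algebra_simps)
    ultimately show "y \<in> (\<Union>q \<in> {q \<in> ?I \<times> ?I \<times> ?I. fst q \<noteq> 0}. ?roots q)"
      by blast
  qed
  moreover have "finite (\<Union>q \<in> {q \<in> ?I \<times> ?I \<times> ?I. fst q \<noteq> 0}. ?roots q)"
    by (intro finite_UN_I finite_Collect_conjI disjI1) (auto intro: finite_quadratic_roots)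
  ultimately show ?thesis by (rule finite_subset)
qed

section \<open>Eventual periodicity\<close>

lemma eventually_periodic_if_reaches_finite_invariant:
  assumes "finite S" and "\<And>s. s \<in> S \<Longrightarrow> f s \<in> S" and "(f ^^ n) y \<in> S"
  shows "eventually_periodic_orbit f y"
proof -
  have "(f ^^ (k + n)) y \<in> S" for k
    by (induction k) (use assms in auto)
  then have "(\<lambda>k. (f ^^ (k + n)) y) ` UNIV \<subseteq> S" by blast
  then have "\<not> inj (\<lambda>k. (f ^^ (k + n)) y)"
    using assms(1) finite_subset range_inj_infinite by blast
  then obtain i j where "i \<noteq> j" "(f ^^ (i + n)) y = (f ^^ (j + n)) y"
    unfolding inj_def by blast
  then show ?thesis
    unfolding eventually_periodic_orbit_def
    by (metis add_less_cancel_right nat_neq_iff)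
qed

lemma sqrt_nonsquare_irrational:
  fixes b :: int
  assumes "b \<ge> 0" "\<not> is_square b"
  shows "sqrt (of_int b) \<notin> \<rat>"
proof
  assume "sqrt (of_int b) \<in> \<rat>"
  then obtain m n :: nat where n: "n \<noteq> 0" and mn: "\<bar>sqrt (of_int b)\<bar> = real m / real n"
    and "coprime m n"
    by (rule Rats_abs_nat_div_natE)
  have "(real m / real n)\<^sup>2 = of_int b"
    using assms(1) by (simp flip: mn)
  then have "real_of_int ((int m)\<^sup>2) = real_of_int (b * (int n)\<^sup>2)"
    using n by (simp add: field_simps)
  then have eq: "(int m)\<^sup>2 = b * (int n)\<^sup>2" by linarith
  then have "(int n)\<^sup>2 dvd (int m)\<^sup>2" by simp
  then have "int n dvd int m" by simp
  then obtain k where "int m = int n * k" by (rule dvdE)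
  with eq n have "b = k\<^sup>2" by (simp add: power_mult_distrib)
  with assms(2) show False by (auto simp: is_nth_power_def)
qed

lemma quadratic_irrational_conjugate_roots:
  assumes "quadratic_irrational x"
  obtains A B C z where "conjugate_roots A B C (x - of_int k) z"
proof -
  obtain a b c :: int where b: "b \<ge> 1" "\<not> is_square b" and c: "c \<noteq> 0"
    and x: "x = (of_int a + sqrt (of_int b)) / of_int c"
    using assms unfolding quadratic_irrational_def by blast
  define d where "d = a - k * c"
  define s where "s = sqrt (of_int b)"
  have s: "s \<notin> \<rat>" unfolding s_def using b by (intro sqrt_nonsquare_irrational) auto
  have s2: "s * s = of_int b" using b by (simp add: s_def)
  define y z where "y = (of_int d + s) / of_int c" and "z = (of_int d - s) / of_int c"
  have "s = of_int c * y - of_int d" "s = of_int d - of_int c * z"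
    using c by (simp_all add: y_def z_def)
  then have "y \<notin> \<rat>" "z \<notin> \<rat>"
    using s by (metis Rats_diff Rats_mult Rats_of_int)+
  then have "conjugate_roots (c\<^sup>2) (- 2 * c * d) (d\<^sup>2 - b) y z"
    unfolding conjugate_roots_def using c s2
    by (simp add: y_def z_def field_simps power2_eq_square)
  moreover have "x - of_int k = y"
    using c by (simp add: x y_def d_def s_def field_simps)
  ultimately show thesis using that by simp
qed

theorem proposition2p3:
  fixes x :: real and a :: "nat \<Rightarrow> int" and l p :: nat
  assumes "quadratic_irrational x"
    and "rcf_expansion x a"
    and "p \<ge> 1"
    and "\<forall>n>l. a (n + p) = a n"
  shows "eventually_periodic_orbit romik (x - of_int (a 0))"
proof -
  have "a 0 = \<lfloor>x\<rfloor>" using assms(2) by (simp add: rcf_expansion_def)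
  then have y: "x - of_int (a 0) \<in> {0..1}"
    by simp linarith
  obtain A B C z where "conjugate_roots A B C (x - of_int (a 0)) z"
    using quadratic_irrational_conjugate_roots[OF assms(1)] .
  from orbit_reaches_reduced[OF this y] obtain n
    where "(romik ^^ n) (x - of_int (a 0)) \<in> reduced_irrationals (B\<^sup>2 - 4 * A * C)" ..
  with finite_reduced_irrationals romik_reduced show ?thesis
    by (rule eventually_periodic_if_reaches_finite_invariant)
qed

end
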